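(* For every real $x$ with $0<x<1$, $$\left(\frac{1-x}{1+\left(\frac{\pi^2}{6}-1\right)x}\right)^x<\frac{\sin(\pi x)}{\pi x}<(1-x)^x.$$ *)

theory Defs
  imports "HOL-Analysis.Analysis"
begin

end

theory Submission
  imports Defs
begin

text \<open>Write \<open>c = pi\<^sup>2 / 6 - 1\<close>, which is the sum of \<open>1 / k\<^sup>2\<close> over \<open>k \<ge> 2\<close>.  Keeping the factor
  \<open>1 - x\<^sup>2\<close> of Euler's product \<open>sin (pi x) / (pi x) = (\<Prod>k\<ge>1. 1 - x\<^sup>2 / k\<^sup>2)\<close> and comparing every
  other factor with an exponential gives, for \<open>0 < x \<le> 1\<close>,
  \<open>(1 - x\<^sup>2) exp (- c x\<^sup>2 - c x\<^sup>4 / 6) \<le> sin (pi x) / (pi x) \<le> (1 - x\<^sup>2) exp (- c x\<^sup>2)\<close>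
  (\<open>sinc_lower\<close> and \<open>sinc_upper\<close>).

  For the lower bound of the theorem it then suffices, after taking logarithms, that
  \<open>ln (1 + x) + (1 - x) ln (1 - x) + x ln (1 + c x) - c x\<^sup>2 - c x\<^sup>4 / 6\<close> is positive.  Taylor bounds show
  that this is at least \<open>x\<^sup>3 (1 + c) ((1 - c) / 2 - x / 6)\<close>, which is positive because
  \<open>c < 2/3\<close>, that is, \<open>pi\<^sup>2 < 10\<close>.

  For the upper bound, \<open>sinc_upper\<close> at \<open>x\<close> is sharp enough for \<open>x \<le> 7/10\<close>, but not near \<open>1\<close>.  There it
  is applied at \<open>t = 1 - x\<close> instead, using \<open>sin (pi x) = sin (pi t)\<close>.\<close>

section \<open>Elementary bounds for the logarithm\<close>

lemma ln_one_minus_upper: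
  fixes x :: real
  assumes "0 \<le> x" "x < 1"
  shows "ln (1 - x) \<le> - x - x\<^sup>2 / 2 - x ^ 3 / 3"
proof -
  let ?f = "\<lambda>t::real. - t - t\<^sup>2 / 2 - t ^ 3 / 3 - ln (1 - t)"
  have "?f 0 \<le> ?f x"
  proof (rule DERIV_nonneg_imp_nondecreasing [OF assms(1)])
    fix t assume t: "0 \<le> t" "t \<le> x"
    have "(?f has_real_derivative - 1 - t - t\<^sup>2 + 1 / (1 - t)) (at t)"
      using t assms by (auto intro!: derivative_eq_intros)
    moreover have "- 1 - t - t\<^sup>2 + 1 / (1 - t) = t ^ 3 / (1 - t)"
      using t assms by (simp add: divide_simps) algebra
    moreover have "t ^ 3 / (1 - t) \<ge> 0"
      using t assms by simp
    ultimately show "\<exists>y. (?f has_real_derivative y) (at t) \<and> y \<ge> 0"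
      by auto
  qed
  then show ?thesis by simp
qed

lemma ln_one_minus_lower:
  fixes u :: real
  assumes "0 \<le> u" "u \<le> 1 / 4"
  shows "- u - 2 / 3 * u\<^sup>2 \<le> ln (1 - u)"
proof -
  let ?f = "\<lambda>t::real. ln (1 - t) + t + 2 / 3 * t\<^sup>2"
  have "?f 0 \<le> ?f u"
  proof (rule DERIV_nonneg_imp_nondecreasing [OF assms(1)])
    fix t assume t: "0 \<le> t" "t \<le> u"
    have "(?f has_real_derivative - 1 / (1 - t) + 1 + 4 / 3 * t) (at t)"
      using t assms by (auto intro!: derivative_eq_intros)
    moreover have "- 1 / (1 - t) + 1 + 4 / 3 * t = t * (1 - 4 * t) / (3 * (1 - t))"
      using t assms by (simp add: divide_simps) algebra
    moreover have "t * (1 - 4 * t) / (3 * (1 - t)) \<ge> 0"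
      using t assms by simp
    ultimately show "\<exists>y. (?f has_real_derivative y) (at t) \<and> y \<ge> 0"
      by auto
  qed
  then show ?thesis by simp
qed

lemma ln_one_plus_lower:
  fixes x :: real
  assumes "0 \<le> x"
  shows "x - x\<^sup>2 / 2 \<le> ln (1 + x)"
proof -
  let ?f = "\<lambda>t::real. ln (1 + t) - t + t\<^sup>2 / 2"
  have "?f 0 \<le> ?f x"
  proof (rule DERIV_nonneg_imp_nondecreasing [OF assms])
    fix t assume t: "0 \<le> t" "t \<le> x"
    have "(?f has_real_derivative 1 / (1 + t) - 1 + t) (at t)"
      using t by (auto intro!: derivative_eq_intros)
    moreover have "1 / (1 + t) - 1 + t = t\<^sup>2 / (1 + t)"
      using t by (simp add: divide_simps) algebra
    moreover have "t\<^sup>2 / (1 + t) \<ge> 0"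
      using t by simp
    ultimately show "\<exists>y. (?f has_real_derivative y) (at t) \<and> y \<ge> 0"
      by auto
  qed
  then show ?thesis by simp
qed

lemma ln_one_plus_upper:
  fixes x :: real
  assumes "0 \<le> x"
  shows "ln (1 + x) \<le> x - x\<^sup>2 / 2 + x ^ 3 / 3"
proof -
  let ?f = "\<lambda>t::real. t - t\<^sup>2 / 2 + t ^ 3 / 3 - ln (1 + t)"
  have "?f 0 \<le> ?f x"
  proof (rule DERIV_nonneg_imp_nondecreasing [OF assms])
    fix t assume t: "0 \<le> t" "t \<le> x"
    have "(?f has_real_derivative 1 - t + t\<^sup>2 - 1 / (1 + t)) (at t)"
      using t by (auto intro!: derivative_eq_intros)
    moreover have "1 - t + t\<^sup>2 - 1 / (1 + t) = t ^ 3 / (1 + t)"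
      using t by (simp add: divide_simps) algebra
    moreover have "t ^ 3 / (1 + t) \<ge> 0"
      using t by simp
    ultimately show "\<exists>y. (?f has_real_derivative y) (at t) \<and> y \<ge> 0"
      by auto
  qed
  then show ?thesis by simp
qed

text \<open>The right-hand side expands as \<open>x\<^sup>3 / 2 - x\<^sup>4 / 6 + \<dots>\<close>: the terms of orders one and two of
  its two summands cancel.\<close>

lemma ln_one_plus_entropy_lower:
  fixes x :: real
  assumes "0 \<le> x" "x < 1"
  shows "x ^ 3 / 2 - x ^ 4 / 6 \<le> ln (1 + x) + (1 - x) * ln (1 - x)"
proof -
  let ?f = "\<lambda>t::real. ln (1 + t) + (1 - t) * ln (1 - t) - t ^ 3 / 2 + t ^ 4 / 6"
  have "?f 0 \<le> ?f x"
  proof (rule DERIV_nonneg_imp_nondecreasing [OF assms(1)])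
    fix t assume t: "0 \<le> t" "t \<le> x"
    have D: "(?f has_real_derivative
        1 / (1 + t) - ln (1 - t) - 1 - 3 / 2 * t\<^sup>2 + 2 / 3 * t ^ 3) (at t)"
      using t assms by (auto intro!: derivative_eq_intros)
    have "1 / (1 + t) - (1 - t + t\<^sup>2 - t ^ 3) = t ^ 4 / (1 + t)"
      using t by (simp add: divide_simps) algebra
    moreover have "t ^ 4 / (1 + t) \<ge> 0"
      using t by simp
    ultimately have "1 / (1 + t) \<ge> 1 - t + t\<^sup>2 - t ^ 3"
      by linarith
    moreover have "ln (1 - t) \<le> - t - t\<^sup>2 / 2 - t ^ 3 / 3"
      using t assms by (intro ln_one_minus_upper) auto
    ultimately have "1 / (1 + t) - ln (1 - t) - 1 - 3 / 2 * t\<^sup>2 + 2 / 3 * t ^ 3 \<ge> 0"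
      by (simp add: field_simps)
    with D show "\<exists>y. (?f has_real_derivative y) (at t) \<and> y \<ge> 0"
      by blast
  qed
  then show ?thesis by simp
qed

section \<open>Bounds from the product formula for the sine\<close>

lemma inverse_squares_tail_limit:
  "(\<lambda>n. \<Sum>k=2..n. 1 / (real k)\<^sup>2) \<longlonglongrightarrow> pi\<^sup>2 / 6 - 1"
proof -
  have "(\<lambda>n. \<Sum>k<n. 1 / (real k + 1)\<^sup>2) \<longlonglongrightarrow> pi\<^sup>2 / 6"
    using inverse_squares_sums by (simp add: sums_def add.commute)
  then have "(\<lambda>n. (\<Sum>k<n. 1 / (real k + 1)\<^sup>2) - 1) \<longlonglongrightarrow> pi\<^sup>2 / 6 - 1"
    by (intro tendsto_intros)
  moreover have "(\<Sum>k<n. 1 / (real k + 1)\<^sup>2) - 1 = (\<Sum>k=2..n. 1 / (real k)\<^sup>2)" if "n \<ge> 1" for n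
    using that by (induction n rule: dec_induct) (simp_all add: add.commute)
  ultimately show ?thesis
    by (rule Lim_transform_eventually [OF _ eventually_sequentiallyI])
qed

lemma sinc_product_limit:
  fixes x :: real
  assumes "x \<noteq> 0"
  shows "(\<lambda>n. (1 - x\<^sup>2) * (\<Prod>k=2..n. 1 - x\<^sup>2 / (real k)\<^sup>2)) \<longlonglongrightarrow> sin (pi * x) / (pi * x)"
proof -
  have "(\<lambda>n. \<Prod>k=1..n. 1 - x\<^sup>2 / (real k)\<^sup>2) \<longlonglongrightarrow> sin (pi * x) / (pi * x)"
    by (rule sin_product_formula_real' [OF assms])
  moreover have "(\<Prod>k=1..n. 1 - x\<^sup>2 / (real k)\<^sup>2)
      = (1 - x\<^sup>2) * (\<Prod>k=2..n. 1 - x\<^sup>2 / (real k)\<^sup>2)" if "n \<ge> 1" for n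
    using that by (simp add: prod.atLeast_Suc_atMost numeral_2_eq_2)
  ultimately show ?thesis
    by (rule Lim_transform_eventually [OF _ eventually_sequentiallyI])
qed

lemma sinc_upper:
  fixes x :: real
  assumes "0 < x" "x \<le> 1"
  shows "sin (pi * x) / (pi * x) \<le> (1 - x\<^sup>2) * exp (- (pi\<^sup>2 / 6 - 1) * x\<^sup>2)"
proof (rule LIMSEQ_le [OF sinc_product_limit])
  have "(\<lambda>n. (1 - x\<^sup>2) * exp (- (\<Sum>k=2..n. 1 / (real k)\<^sup>2) * x\<^sup>2))
      \<longlonglongrightarrow> (1 - x\<^sup>2) * exp (- (pi\<^sup>2 / 6 - 1) * x\<^sup>2)"
    by (intro tendsto_intros inverse_squares_tail_limit)
  then show "(\<lambda>n. (1 - x\<^sup>2) * exp (- (\<Sum>k=2..n. 1 / (real k)\<^sup>2) * x\<^sup>2))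
      \<longlonglongrightarrow> (1 - x\<^sup>2) * exp (- (pi\<^sup>2 / 6 - 1) * x\<^sup>2)" .
  have x2: "x\<^sup>2 \<le> 1"
    using assms by (simp add: power_le_one)
  have "(\<Prod>k=2..n. 1 - x\<^sup>2 / (real k)\<^sup>2) \<le> exp (- (\<Sum>k=2..n. 1 / (real k)\<^sup>2) * x\<^sup>2)" for n
  proof -
    have "(\<Prod>k=2..n. 1 - x\<^sup>2 / (real k)\<^sup>2) \<le> (\<Prod>k=2..n. exp (- (x\<^sup>2 / (real k)\<^sup>2)))"
    proof (rule prod_mono, safe)
      fix k :: nat assume "k \<in> {2..n}"
      then have k: "1 \<le> (real k)\<^sup>2" by simp
      with x2 have "x\<^sup>2 \<le> (real k)\<^sup>2"
        by linarith
      with k show "0 \<le> 1 - x\<^sup>2 / (real k)\<^sup>2"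
        by (auto simp: divide_le_eq_1)
      show "1 - x\<^sup>2 / (real k)\<^sup>2 \<le> exp (- (x\<^sup>2 / (real k)\<^sup>2))"
        using exp_ge_add_one_self [of "- (x\<^sup>2 / (real k)\<^sup>2)"] by simp
    qed
    also have "\<dots> = exp (- (\<Sum>k=2..n. 1 / (real k)\<^sup>2) * x\<^sup>2)"
      by (simp flip: exp_sum sum_negf add: sum_distrib_right)
    finally show ?thesis .
  qed
  then show "\<exists>N. \<forall>n\<ge>N. (1 - x\<^sup>2) * (\<Prod>k=2..n. 1 - x\<^sup>2 / (real k)\<^sup>2)
      \<le> (1 - x\<^sup>2) * exp (- (\<Sum>k=2..n. 1 / (real k)\<^sup>2) * x\<^sup>2)"
    using x2 by (intro exI allI impI mult_left_mono) auto
qed (use assms in auto)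

text \<open>For \<open>k \<ge> 2\<close> the quantity \<open>u = x\<^sup>2 / k\<^sup>2\<close> is at most \<open>x\<^sup>2 / 4\<close>, so the quadratic term
  \<open>2/3 u\<^sup>2\<close> of \<open>ln_one_minus_lower\<close> is at most \<open>x\<^sup>4 / 6\<close> times \<open>1 / k\<^sup>2\<close>; this makes the same sum
  control both orders.\<close>

lemma sinc_lower:
  fixes x :: real
  assumes "0 < x" "x \<le> 1"
  shows "(1 - x\<^sup>2) * exp (- (pi\<^sup>2 / 6 - 1) * (x\<^sup>2 + x ^ 4 / 6)) \<le> sin (pi * x) / (pi * x)"
proof (rule LIMSEQ_le [OF _ sinc_product_limit])
  have "(\<lambda>n. (1 - x\<^sup>2) * exp (- (\<Sum>k=2..n. 1 / (real k)\<^sup>2) * (x\<^sup>2 + x ^ 4 / 6)))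
      \<longlonglongrightarrow> (1 - x\<^sup>2) * exp (- (pi\<^sup>2 / 6 - 1) * (x\<^sup>2 + x ^ 4 / 6))"
    by (intro tendsto_mult tendsto_exp tendsto_minus tendsto_const inverse_squares_tail_limit)
  then show "(\<lambda>n. (1 - x\<^sup>2) * exp (- (\<Sum>k=2..n. 1 / (real k)\<^sup>2) * (x\<^sup>2 + x ^ 4 / 6)))
      \<longlonglongrightarrow> (1 - x\<^sup>2) * exp (- (pi\<^sup>2 / 6 - 1) * (x\<^sup>2 + x ^ 4 / 6))" .
  have x2: "x\<^sup>2 \<le> 1"
    using assms by (simp add: power_le_one)
  have "exp (- (\<Sum>k=2..n. 1 / (real k)\<^sup>2) * (x\<^sup>2 + x ^ 4 / 6)) \<le> (\<Prod>k=2..n. 1 - x\<^sup>2 / (real k)\<^sup>2)" for n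
  proof -
    have "exp (- (\<Sum>k=2..n. 1 / (real k)\<^sup>2) * (x\<^sup>2 + x ^ 4 / 6))
        = (\<Prod>k=2..n. exp (- (1 / (real k)\<^sup>2 * (x\<^sup>2 + x ^ 4 / 6))))"
      by (simp flip: exp_sum sum_negf add: sum_distrib_right)
    also have "\<dots> \<le> (\<Prod>k=2..n. 1 - x\<^sup>2 / (real k)\<^sup>2)"
    proof (rule prod_mono, safe)
      fix k :: nat assume kn: "k \<in> {2..n}"
      then have "2\<^sup>2 \<le> (real k)\<^sup>2"
        by (intro power_mono) auto
      then have k: "4 \<le> (real k)\<^sup>2" by simp
      define u where "u = x\<^sup>2 / (real k)\<^sup>2"
      have u: "0 \<le> u" "u \<le> x\<^sup>2 / 4"
        using k kn divide_left_mono [of 4 "(real k)\<^sup>2" "x\<^sup>2"] by (simp_all add: u_def)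
      have "u * u \<le> u * (x\<^sup>2 / 4)"
        using u by (intro mult_left_mono)
      also have "\<dots> = x ^ 4 / 4 / (real k)\<^sup>2"
        by (simp add: u_def power2_eq_square power4_eq_xxxx)
      finally have "- (1 / (real k)\<^sup>2 * (x\<^sup>2 + x ^ 4 / 6)) \<le> - u - 2 / 3 * u\<^sup>2"
        by (simp add: u_def power2_eq_square add_divide_distrib distrib_left)
      also have "\<dots> \<le> ln (1 - u)"
        using u x2 by (intro ln_one_minus_lower) auto
      finally have "- (1 / (real k)\<^sup>2 * (x\<^sup>2 + x ^ 4 / 6)) \<le> ln (1 - u)" .
      moreover have "0 < 1 - u"
        using u x2 by linarith
      ultimately show "exp (- (1 / (real k)\<^sup>2 * (x\<^sup>2 + x ^ 4 / 6))) \<le> 1 - x\<^sup>2 / (real k)\<^sup>2"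
        by (simp add: ln_ge_iff flip: u_def)
    qed simp
    finally show ?thesis .
  qed
  then show "\<exists>N. \<forall>n\<ge>N. (1 - x\<^sup>2) * exp (- (\<Sum>k=2..n. 1 / (real k)\<^sup>2) * (x\<^sup>2 + x ^ 4 / 6))
      \<le> (1 - x\<^sup>2) * (\<Prod>k=2..n. 1 - x\<^sup>2 / (real k)\<^sup>2)"
    using x2 by (intro exI allI impI mult_left_mono) auto
qed (use assms in auto)

section \<open>The two inequalities\<close>

lemma inverse_squares_tail_bounds:
  "3 / 5 < pi\<^sup>2 / 6 - 1" "pi\<^sup>2 / 6 - 1 < 2 / 3"
proof -
  have "3.14\<^sup>2 \<le> pi\<^sup>2" "pi\<^sup>2 \<le> 3.15\<^sup>2"
    using pi_approx by (auto intro!: power_mono)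
  then show "3 / 5 < pi\<^sup>2 / 6 - 1" "pi\<^sup>2 / 6 - 1 < 2 / 3"
    by (simp_all add: power2_eq_square)
qed

lemma one_minus_square_eq_exp:
  fixes x :: real
  assumes "0 \<le> x" "x < 1"
  shows "1 - x\<^sup>2 = exp (ln (1 - x) + ln (1 + x))"
  using assms by (simp add: exp_add power2_eq_square algebra_simps)

lemma powr_less_sinc:
  fixes x :: real
  assumes x: "0 < x" "x < 1"
  shows "((1 - x) / (1 + (pi\<^sup>2 / 6 - 1) * x)) powr x < sin (pi * x) / (pi * x)"
proof -
  define c where "c = pi\<^sup>2 / 6 - 1"
  have c: "0 < c" "c < 2 / 3"
    using inverse_squares_tail_bounds by (auto simp: c_def)
  have cx: "0 < c * x"
    using c x by simp
  have "x * (c * x - (c * x)\<^sup>2 / 2) \<le> x * ln (1 + c * x)"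
    using cx x by (intro mult_left_mono ln_one_plus_lower) auto
  moreover have "x ^ 3 / 2 - x ^ 4 / 6 \<le> ln (1 + x) + (1 - x) * ln (1 - x)"
    using x by (intro ln_one_plus_entropy_lower) auto
  moreover have "0 < x ^ 3 * (1 + c) * ((1 - c) / 2 - x / 6)"
    using x c by (intro mult_pos_pos) auto
  moreover have "x ^ 3 * (1 + c) * ((1 - c) / 2 - x / 6)
      = (x ^ 3 / 2 - x ^ 4 / 6) + x * (c * x - (c * x)\<^sup>2 / 2) - c * (x\<^sup>2 + x ^ 4 / 6)"
    by (simp add: field_simps) algebra
  ultimately have "0 < ln (1 + x) + (1 - x) * ln (1 - x) + x * ln (1 + c * x) - c * (x\<^sup>2 + x ^ 4 / 6)"
    by linarith
  then have less: "x * (ln (1 - x) - ln (1 + c * x))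
      < ln (1 - x) + ln (1 + x) - c * (x\<^sup>2 + x ^ 4 / 6)"
    by (simp add: algebra_simps)
  have "((1 - x) / (1 + c * x)) powr x = exp (x * (ln (1 - x) - ln (1 + c * x)))"
    using x cx by (simp add: powr_def ln_div)
  also have "\<dots> < exp (ln (1 - x) + ln (1 + x) - c * (x\<^sup>2 + x ^ 4 / 6))"
    using less by simp
  also have "\<dots> = (1 - x\<^sup>2) * exp (- c * (x\<^sup>2 + x ^ 4 / 6))"
    using x by (simp add: one_minus_square_eq_exp flip: exp_add)
  also have "\<dots> \<le> sin (pi * x) / (pi * x)"
    using sinc_lower [of x] x by (simp add: c_def)
  finally show ?thesis
    by (simp add: c_def)
qed

lemma sinc_less_powr:
  fixes x :: real
  assumes x: "0 < x" "x < 1"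
  shows "sin (pi * x) / (pi * x) < (1 - x) powr x"
proof (cases "x \<le> 7 / 10")
  case True
  define c where "c = pi\<^sup>2 / 6 - 1"
  have c: "3 / 5 < c"
    using inverse_squares_tail_bounds by (auto simp: c_def)
  have "0 \<le> x ^ 3"
    using x by simp
  then have "ln (1 - x) \<le> - x - x\<^sup>2 / 2"
    using ln_one_minus_upper [of x] x by linarith
  then have "(1 - x) * ln (1 - x) \<le> (1 - x) * (- x - x\<^sup>2 / 2)"
    using x by (intro mult_left_mono) auto
  moreover have "ln (1 + x) \<le> x - x\<^sup>2 / 2 + x ^ 3 / 3"
    using x by (intro ln_one_plus_upper) auto
  moreover have "(1 - x) * (- x - x\<^sup>2 / 2) + (x - x\<^sup>2 / 2 + x ^ 3 / 3) - c * x\<^sup>2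
      = x\<^sup>2 * (5 / 6 * x - c)"
    by (simp add: field_simps) algebra
  \<comment> \<open>\<open>5/6 * 7/10 < 3/5 < c\<close>\<close>
  moreover have "x\<^sup>2 * (5 / 6 * x - c) < 0"
    using x c True by (intro mult_pos_neg) auto
  ultimately have "(1 - x) * ln (1 - x) + ln (1 + x) - c * x\<^sup>2 < 0"
    by linarith
  then have less: "ln (1 - x) + ln (1 + x) - c * x\<^sup>2 < x * ln (1 - x)"
    by (simp add: algebra_simps)
  have "sin (pi * x) / (pi * x) \<le> (1 - x\<^sup>2) * exp (- c * x\<^sup>2)"
    using sinc_upper [of x] x by (simp add: c_def)
  also have "\<dots> = exp (ln (1 - x) + ln (1 + x) - c * x\<^sup>2)"
    using x by (simp add: one_minus_square_eq_exp flip: exp_add)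
  also have "\<dots> < (1 - x) powr x"
    using less x by (simp add: powr_def)
  finally show ?thesis .
next
  case False
  define c where "c = pi\<^sup>2 / 6 - 1"
  have c: "3 / 5 < c"
    using inverse_squares_tail_bounds by (auto simp: c_def)
  define t where "t = 1 - x"
  have t: "0 < t" "t < 3 / 10"
    using x False by (auto simp: t_def)
  have "t * ln t \<le> t * (t - 1)"
    using t by (intro mult_left_mono ln_le_minus_one) auto
  moreover have "ln (1 + t) \<le> t - t\<^sup>2 / 2 + t ^ 3 / 3"
    using t by (intro ln_one_plus_upper) auto
  moreover have "t * (t - 1) + (t - t\<^sup>2 / 2 + t ^ 3 / 3) - c * t\<^sup>2 = t\<^sup>2 * (1 / 2 + t / 3 - c)"
    by (simp add: field_simps) algebra
  \<comment> \<open>\<open>1/2 + 1/3 * 3/10 = 3/5 < c\<close>\<close>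
  moreover have "t\<^sup>2 * (1 / 2 + t / 3 - c) < 0"
    using t c by (intro mult_pos_neg) auto
  ultimately have "t * ln t + ln (1 + t) - c * t\<^sup>2 < 0"
    by linarith
  then have less: "ln t + ln (1 + t) - c * t\<^sup>2 < x * ln t"
    by (simp add: t_def algebra_simps)
  have "pi * x = pi - pi * t"
    by (simp add: t_def algebra_simps)
  then have "sin (pi * x) = sin (pi * t)"
    by simp
  then have "sin (pi * x) / (pi * x) = t / x * (sin (pi * t) / (pi * t))"
    using t by simp
  also have "\<dots> \<le> t / x * ((1 - t\<^sup>2) * exp (- c * t\<^sup>2))"
    using sinc_upper [of t] t x by (intro mult_left_mono) (auto simp: c_def)
  \<comment> \<open>the factor \<open>1 - t = x\<close> of \<open>1 - t\<^sup>2\<close> cancels the denominator\<close>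
  also have "\<dots> = t * (1 + t) * exp (- c * t\<^sup>2)"
    using x by (simp add: t_def field_simps power2_eq_square)
  also have "\<dots> = exp (ln t + ln (1 + t) - c * t\<^sup>2)"
    using t by (simp add: exp_add exp_diff exp_minus field_simps)
  also have "\<dots> < t powr x"
    using less t by (simp add: powr_def)
  finally show ?thesis
    by (simp add: t_def)
qed

theorem corollary1p7:
  fixes x :: real
  assumes "0 < x" and "x < 1"
  shows "((1 - x) / (1 + (pi\<^sup>2 / 6 - 1) * x)) powr x < sin (pi * x) / (pi * x)
    \<and> sin (pi * x) / (pi * x) < (1 - x) powr x"
  using powr_less_sinc [OF assms] sinc_less_powr [OF assms] by blast

end
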